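(* Let $t\ge 3$ be an odd integer, let $d$ be a positive integer with $d\ge \frac{t+1}{2}$, and let $S=(d,d,d,\ldots)$. Then $$\chi_S(G_t)\ge 1+t\left(d-\frac{t-3}{2}\right).$$
   Context: For an odd integer $t\ge 3$, $G_t$ denotes the integer distance graph $G(\mathbb{Z},\{2,t\})$: its vertex set is $\mathbb{Z}$, and distinct $i,j\in\mathbb{Z}$ are adjacent if and only if $|i-j|\in\{2,t\}$. For a graph $G$ and a non-decreasing sequence $S=(a_1,a_2,\ldots)$ of positive integers, an $S$-packing $k$-coloring of $G$ is a map $f:V(G)\to\{1,\ldots,k\}$ such that any two distinct vertices $u,v$ with $f(u)=f(v)=i$ satisfy $d_G(u,v)>a_i$, where $d_G$ is the shortest-path distance. The $S$-packing chromatic number $\chi_S(G)$ is the smallest $k$ for which $G$ has an $S$-packing $k$-coloring. (For $S=(d,d,\ldots)$ this is the $d$-distance chromatic number.) *)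

theory Defs
  imports "Graph_Theory.Graph_Theory"
begin

text \<open>
  Graphs are symmetric loop-free digraphs, as in \<open>Graph_Theory\<close>.
\<close>

definition integer_distance_graph :: "int set \<Rightarrow> int pair_pre_digraph" where
  "integer_distance_graph D =
     \<lparr> pverts = UNIV, parcs = {(i, j). i \<noteq> j \<and> \<bar>i - j\<bar> \<in> D} \<rparr>"

lemma pair_bidirected_integer_distance_graph:
  "pair_bidirected_digraph (integer_distance_graph D)"
  by unfold_locales
    (auto simp: integer_distance_graph_def symmetric_def sym_def abs_minus_commute)

text \<open>
  The shortest-path distance is the cost of a cheapest walk when every edge costs 1;
  it is \<open>\<infinity>\<close> if there is no walk.
\<close>

definition graph_dist :: "('a, 'b) pre_digraph \<Rightarrow> 'a \<Rightarrow> 'a \<Rightarrow> ereal" where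
  "graph_dist G u v = wf_digraph.\<mu> G (\<lambda>_. 1) u v"

text \<open>
  The sequence \<open>S\<close> is indexed from 1; the value \<open>S 0\<close> is irrelevant.
\<close>

definition packing_coloring ::
  "('a, 'b) pre_digraph \<Rightarrow> (nat \<Rightarrow> nat) \<Rightarrow> nat \<Rightarrow> ('a \<Rightarrow> nat) \<Rightarrow> bool" where
  "packing_coloring G S k f \<longleftrightarrow>
     f \<in> verts G \<rightarrow> {1..k} \<and>
     (\<forall>u \<in> verts G. \<forall>v \<in> verts G. \<forall>i. u \<noteq> v \<and> f u = i \<and> f v = i \<longrightarrow>
        graph_dist G u v > ereal (real (S i)))"

definition packing_chromatic_number :: "('a, 'b) pre_digraph \<Rightarrow> (nat \<Rightarrow> nat) \<Rightarrow> nat" where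
  "packing_chromatic_number G S = (LEAST k. \<exists>f. packing_coloring G S k f)"

text \<open>
  For a constant sequence and a distance set that is bounded above, a packing coloring exists, so
  the \<open>LEAST\<close> in the definition above is attained.
\<close>

lemma integer_distance_graph_walk_bound:
  assumes "pcas u p v" "set p \<subseteq> parcs (integer_distance_graph D)"
    and "\<And>x. x \<in> D \<Longrightarrow> x \<le> m"
  shows "\<bar>u - v\<bar> \<le> int (length p) * m"
  using assms(1,2)
proof (induction p arbitrary: u)
  case Nil
  then show ?case by simp
next
  case (Cons e p)
  have "\<bar>snd e - v\<bar> \<le> int (length p) * m"
    using Cons by simp
  moreover have "\<bar>u - snd e\<bar> \<le> m"
    using Cons.prems assms(3) by (auto simp: integer_distance_graph_def)
  ultimately show ?case
    by (simp add: algebra_simps)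
qed

lemma ex_packing_coloring_integer_distance_graph:
  assumes "0 \<le> m" "\<And>x. x \<in> D \<Longrightarrow> x \<le> m"
  shows "\<exists>k f. packing_coloring (integer_distance_graph D) (\<lambda>_. d) k f"
proof (intro exI)
  let ?G = "integer_distance_graph D"
  let ?N = "(int d + 1) * m + 1"
  let ?f = "\<lambda>i. nat (i mod ?N) + 1"
  interpret pair_bidirected_digraph ?G
    by (rule pair_bidirected_integer_distance_graph)
  have N: "?N > 0" using assms(1) by (simp add: add_nonneg_pos)
  have "ereal (real d) < graph_dist ?G u v" if "u \<noteq> v" "?f u = ?f v" for u v :: int
  proof -
    have "u mod ?N = v mod ?N"
      using that(2) N pos_mod_sign[of ?N u] pos_mod_sign[of ?N v]
      by (metis add_right_cancel nat_eq_iff2 nat_0_le)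
    then have "?N dvd u - v" by (simp add: mod_eq_dvd_iff)
    then have far: "?N \<le> \<bar>u - v\<bar>" using that(1) by (intro zdvd_imp_le) simp_all
    have "ereal (real d + 1) \<le> ereal (awalk_cost (\<lambda>_. 1) p)" if "awalk u p v" for p
    proof -
      have "\<bar>u - v\<bar> \<le> int (length p) * m"
        using that by (intro integer_distance_graph_walk_bound assms(2)) (auto simp: awalk_def)
      then have "(int d + 1) * m < int (length p) * m"
        using far by linarith
      then have "int d + 1 < int (length p)"
        using assms(1) by (metis mult_less_cancel_right not_less)
      then show ?thesis by (simp add: awalk_cost_def sum_list_triv)
    qed
    then have "ereal (real d + 1) \<le> graph_dist ?G u v"
      unfolding graph_dist_def \<mu>_def by (intro INF_greatest) simp
    then show ?thesis by (rule less_le_trans[rotated]) simp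
  qed
  moreover have "?f u \<in> {1..nat ?N}" for u
  proof -
    have "0 \<le> u mod ?N" "u mod ?N < ?N"
      using N by (rule pos_mod_sign, rule pos_mod_bound)
    then have "nat (u mod ?N) < nat ?N" by linarith
    then show ?thesis by (simp only: atLeastAtMost_iff) linarith
  qed
  ultimately show "packing_coloring ?G (\<lambda>_. d) (nat ?N) ?f"
    unfolding packing_coloring_def by fastforce
qed

end

theory Submission
  imports Defs
begin

text \<open>
  With \<open>K = d - (t - 3) / 2\<close>, every integer \<open>n\<close> with \<open>\<bar>n\<bar> \<le> t * K\<close> can be written as
  \<open>a * t + 2 * b\<close> with \<open>\<bar>a\<bar> + \<bar>b\<bar> \<le> d\<close>. Hence the \<open>t * K + 1\<close> consecutive
  integers \<open>0, \<dots>, t * K\<close> are pairwise at distance at most \<open>d\<close> and need different colors.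
\<close>

text \<open>Two vertices of \<open>A\<close> sharing a color would be farther apart than
  \<open>d\<close>, so a coloring that attains the minimum is injective on \<open>A\<close>.
  Existence of some coloring ensures that the \<open>LEAST\<close> is attained.\<close>

lemma card_le_packing_chromatic_number:
  assumes "\<exists>k f. packing_coloring G (\<lambda>_. d) k f" and "A \<subseteq> verts G"
    and close: "\<And>u v. u \<in> A \<Longrightarrow> v \<in> A \<Longrightarrow> graph_dist G u v \<le> ereal (real d)"
  shows "card A \<le> packing_chromatic_number G (\<lambda>_. d)"
proof -
  let ?k = "packing_chromatic_number G (\<lambda>_. d)"
  obtain f where f: "packing_coloring G (\<lambda>_. d) ?k f"
    using LeastI_ex[OF assms(1)] unfolding packing_chromatic_number_def by blast
  have "inj_on f A"
  proof (rule inj_onI, rule ccontr)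
    fix u v assume uv: "u \<in> A" "v \<in> A" "f u = f v" "u \<noteq> v"
    then have "ereal (real d) < graph_dist G u v"
      using f assms(2) unfolding packing_coloring_def by blast
    with close[OF uv(1,2)] show False by simp
  qed
  moreover have "f ` A \<subseteq> {1..?k}"
    using f assms(2) unfolding packing_coloring_def by blast
  ultimately have "card A \<le> card {1..?k}"
    by (intro card_inj_on_le) auto
  then show ?thesis by simp
qed

text \<open>The sign of \<open>z\<close> is left open so that one induction serves steps to the
  right and to the left.\<close>

lemma ex_awalk_multiple:
  assumes "\<bar>z\<bar> \<in> D" "z \<noteq> 0"
  shows "\<exists>p. pre_digraph.awalk (integer_distance_graph D) u p (u + int n * z) \<and> length p = n"
proof -
  interpret pair_bidirected_digraph "integer_distance_graph D"
    by (rule pair_bidirected_integer_distance_graph)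
  show ?thesis
  proof (induction n arbitrary: u)
    case 0
    have "awalk u [] u"
      unfolding awalk_Nil_iff by (simp add: integer_distance_graph_def)
    then show ?case by simp
  next
    case (Suc n)
    obtain p where "awalk (u + z) p (u + z + int n * z)" "length p = n"
      using Suc.IH by blast
    moreover have "(u, u + z) \<in> parcs (integer_distance_graph D)"
      using assms by (simp add: integer_distance_graph_def)
    ultimately have "awalk u ((u, u + z) # p) (u + int (Suc n) * z)"
      by (simp add: awalk_Cons_iff algebra_simps)
    then show ?case
      using \<open>length p = n\<close> by (intro exI[of _ "(u, u + z) # p"]) simp
  qed
qed

lemma ex_awalk_int_multiple:
  assumes "z \<in> D" "z > 0"
  shows "\<exists>p. pre_digraph.awalk (integer_distance_graph D) u p (u + a * z) \<and> length p = nat \<bar>a\<bar>"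
proof (cases "a \<ge> 0")
  case True
  then show ?thesis
    using ex_awalk_multiple[of z D u "nat \<bar>a\<bar>"] assms by simp
next
  case False
  then show ?thesis
    using ex_awalk_multiple[of "- z" D u "nat \<bar>a\<bar>"] assms by simp
qed

text \<open>Concatenating the steps of length \<open>x\<close> with those of length \<open>y\<close>
  gives a walk whose cost bounds the infimum from above.\<close>

lemma graph_dist_integer_distance_graph_le:
  assumes "x \<in> D" "x > 0" "y \<in> D" "y > 0"
  shows "graph_dist (integer_distance_graph D) u (u + a * x + b * y) \<le> ereal (real_of_int (\<bar>a\<bar> + \<bar>b\<bar>))"
proof -
  interpret pair_bidirected_digraph "integer_distance_graph D"
    by (rule pair_bidirected_integer_distance_graph)
  obtain p q where p: "awalk u p (u + a * x)" "length p = nat \<bar>a\<bar>"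
    and q: "awalk (u + a * x) q (u + a * x + b * y)" "length q = nat \<bar>b\<bar>"
    using ex_awalk_int_multiple assms by meson
  have "awalk u (p @ q) (u + a * x + b * y)"
    using p(1) q(1) by (rule awalk_appendI)
  then have "graph_dist (integer_distance_graph D) u (u + a * x + b * y)
      \<le> ereal (awalk_cost (\<lambda>_. 1) (p @ q))"
    unfolding graph_dist_def \<mu>_def by (intro INF_lower) simp
  also have "awalk_cost (\<lambda>_. 1) (p @ q) = real_of_int (\<bar>a\<bar> + \<bar>b\<bar>)"
    using p(2) q(2) by (simp add: awalk_cost_def sum_list_triv)
  finally show ?thesis .
qed

text \<open>Divide \<open>n\<close> by \<open>2 * s + 1\<close>: an even remainder is covered by
  steps of length 2 from the multiple below, an odd one by steps of length 2 from a neighboring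
  multiple that makes the difference even.\<close>

lemma ex_short_representation_nonneg:
  fixes s K n :: int
  assumes "s \<ge> 1" "K \<ge> 2" "0 \<le> n" "n \<le> (2 * s + 1) * K"
  shows "\<exists>a b. n = a * (2 * s + 1) + b * 2 \<and> \<bar>a\<bar> + \<bar>b\<bar> \<le> K + s - 1"
proof -
  let ?t = "2 * s + 1"
  define q r where "q = n div ?t" and "r = n mod ?t"
  have n: "n = q * ?t + r"
    unfolding q_def r_def by (rule div_mult_mod_eq[symmetric])
  have r: "0 \<le> r" "r \<le> 2 * s" and q: "0 \<le> q"
    using assms pos_mod_bound[of ?t n] by (auto simp: q_def r_def pos_imp_zdiv_nonneg_iff)
  have "q \<le> K"
    using zdiv_mono1[OF assms(4), of ?t] assms(1) by (simp add: q_def)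
  show ?thesis
  proof (cases "q = K")
    case True
    then have "r = 0" using n r assms(4) by (simp add: algebra_simps)
    with True n show ?thesis using assms by (intro exI[of _ K] exI[of _ 0]) simp
  next
    case False
    with \<open>q \<le> K\<close> have qK: "q \<le> K - 1" by simp
    show ?thesis
    proof (cases "even r")
      case True
      \<comment> \<open>Here \<open>m \<le> s\<close>, so the cost \<open>q + m\<close> is at most
        \<open>(K - 1) + s\<close>.\<close>
      then obtain m where "r = 2 * m" by blast
      then show ?thesis
        using n r q qK by (intro exI[of _ q] exI[of _ m]) simp
    next
      case odd: False
      then obtain m where m: "r = 2 * m + 1" by (rule oddE)
      \<comment> \<open>Rounding up to the next multiple of \<open>t\<close> costs one step too many when \<open>r = 1\<close>
        and \<open>q = K - 1\<close>; then one rounds down to \<open>(q - 1) * t\<close> instead.\<close>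
      show ?thesis
      proof (cases "m = 0 \<and> q \<ge> 1")
        case True
        then show ?thesis
          using n m q qK assms
          by (intro exI[of _ "q - 1"] exI[of _ "s + 1"]) (simp add: algebra_simps)
      next
        \<comment> \<open>The cost is \<open>q + 1 + s - m\<close>. Either \<open>m \<ge> 1\<close>
          absorbs the extra step, or \<open>m = q = 0\<close> and the cost \<open>s + 1\<close> is
          allowed because \<open>K \<ge> 2\<close>.\<close>
        case False
        then show ?thesis
          using n m q qK r assms
          by (intro exI[of _ "q + 1"] exI[of _ "m - s"]) (auto simp: algebra_simps)
      qed
    qed
  qed
qed

text \<open>Negating both coefficients represents \<open>- n\<close> at the same cost.\<close>

lemma ex_short_representation:
  fixes s K n :: int
  assumes "s \<ge> 1" "K \<ge> 2" "\<bar>n\<bar> \<le> (2 * s + 1) * K"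
  shows "\<exists>a b. n = a * (2 * s + 1) + b * 2 \<and> \<bar>a\<bar> + \<bar>b\<bar> \<le> K + s - 1"
proof -
  obtain a b where ab: "\<bar>n\<bar> = a * (2 * s + 1) + b * 2" "\<bar>a\<bar> + \<bar>b\<bar> \<le> K + s - 1"
    using ex_short_representation_nonneg[OF assms(1,2) abs_ge_zero assms(3)] by blast
  show ?thesis
  proof (cases "n \<ge> 0")
    case True
    with ab show ?thesis by auto
  next
    case False
    with ab show ?thesis
      by (intro exI[of _ "- a"] exI[of _ "- b"]) (simp add: algebra_simps)
  qed
qed

theorem theorem5:
  fixes t :: int and d :: nat
  assumes "odd t" and "t \<ge> 3"
    and "d > 0" and "real d \<ge> (real_of_int t + 1) / 2"
  shows "real (packing_chromatic_number (with_proj (integer_distance_graph {2, t})) (\<lambda>_. d))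
           \<ge> 1 + real_of_int t * (real d - (real_of_int t - 3) / 2)"
proof -
  let ?G = "integer_distance_graph {2, t}"
  obtain s where t: "t = 2 * s + 1" using assms(1) by (rule oddE)
  \<comment> \<open>Since \<open>(t - 3) / 2 = s - 1\<close>, this is the integer form of the factor
    in the bound. It makes \<open>K + s - 1\<close> equal to \<open>d\<close>, and the lower bound
    on \<open>d\<close> becomes \<open>K \<ge> 2\<close>.\<close>
  define K where "K = int d - s + 1"
  have s: "s \<ge> 1" using assms(2) t by simp
  have "real d \<ge> real_of_int (s + 1)" using assms(4) t by simp
  then have K: "K \<ge> 2" unfolding K_def by linarith
  have "card {0..t * K} \<le> packing_chromatic_number ?G (\<lambda>_. d)"
  proof (rule card_le_packing_chromatic_number)
    show "\<exists>k f. packing_coloring ?G (\<lambda>_. d) k f"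
      using assms(2) by (intro ex_packing_coloring_integer_distance_graph[of t]) auto
    show "{0..t * K} \<subseteq> verts ?G" by (simp add: integer_distance_graph_def)
    fix u v assume "u \<in> {0..t * K}" "v \<in> {0..t * K}"
    then have "\<bar>v - u\<bar> \<le> (2 * s + 1) * K" using t by auto
    then obtain a b where ab: "v - u = a * t + b * 2" "\<bar>a\<bar> + \<bar>b\<bar> \<le> K + s - 1"
      using ex_short_representation[OF s K] t by blast
    then have v: "v = u + a * t + b * 2" by simp
    have "graph_dist ?G u v \<le> ereal (real_of_int (\<bar>a\<bar> + \<bar>b\<bar>))"
      unfolding v using assms(2) by (intro graph_dist_integer_distance_graph_le) auto
    also have "\<dots> \<le> ereal (real d)" using ab(2) by (simp add: K_def)
    finally show "graph_dist ?G u v \<le> ereal (real d)" .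
  qed
  \<comment> \<open>Nonnegativity makes the cardinality of the interval exactly
    \<open>t * K + 1\<close>, with no truncation by \<open>nat\<close>.\<close>
  moreover have "0 \<le> t * K" using assms(2) K by simp
  ultimately have "1 + t * K \<le> int (packing_chromatic_number ?G (\<lambda>_. d))" by simp
  then have "real_of_int (1 + t * K) \<le> real (packing_chromatic_number ?G (\<lambda>_. d))" by linarith
  moreover have "real_of_int K = real d - (real_of_int t - 3) / 2"
    by (simp add: K_def t field_simps)
  ultimately show ?thesis by simp
qed

end
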